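(* Let $n=2N$ with $N\ge 1$. Suppose $U\in\mathbf{M}_n(\mathbb{C})$ satisfies $U^{\sharp}=U$ and $\left\Vert U^{*}U-I\right\Vert\le\frac34$. Let $$V_{1}=\frac{1}{2}\left(U+\left(U^{-1}\right)^{*}\right),\qquad V=\frac{1}{2}\left(V_{1}+\left(V_{1}^{-1}\right)^{*}\right).$$ If a unitary $Q\in\mathbf{M}_n(\mathbb{C})$ and a matrix $T\in\mathbf{M}_n(\mathbb{C})$ form a $J$-skew-symmetric Schur decomposition of $V$, and if $D\in\mathbf{M}_n(\mathbb{C})$ is the diagonal unitary matrix with $$D_{jj}=\frac{1}{|T_{jj}|}T_{jj}\qquad(1\le j\le n),$$ then $D$ is $J$-skew-symmetric and $$\left\Vert U-QDQ^{*}\right\Vert \leq \tfrac{7}{10}\sqrt{n}\left\Vert U^{*}U-I\right\Vert ^{2}+\tfrac{7}{10}\left\Vert U^{*}U-I\right\Vert .$$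
   Context: $\mathbf{M}_n(\mathbb{C})$ is the set of $n\times n$ complex matrices, $X^{*}$ is the conjugate transpose, $X^{\mathrm T}$ the transpose, $I$ an identity matrix, and $\|A\|=\sup_{\mathbf{v}\ne 0}\|A\mathbf{v}\|_2/\|\mathbf{v}\|_2$ is the operator norm. For $n=2N$, writing matrices in $N\times N$ blocks, the dual operation is $$\begin{bmatrix}A&B\\C&D\end{bmatrix}^{\sharp}=\begin{bmatrix}D^{\mathrm T}&-B^{\mathrm T}\\-C^{\mathrm T}&A^{\mathrm T}\end{bmatrix},$$ equivalently $X^{\sharp}=-JX^{\mathrm T}J$ with $J=\begin{bmatrix}0&I\\-I&0\end{bmatrix}$. A matrix $X$ is $J$-skew-symmetric when $X^{\sharp}=X$. A $J$-skew-symmetric Schur decomposition of a $J$-skew-symmetric matrix $X\in\mathbf{M}_n(\mathbb{C})$ is a pair $(Q,T)$ of $n\times n$ matrices such that $Q$ is unitary, $Q^{\sharp}=Q^{*}$, $X=QTQ^{*}$, and $$T=\begin{bmatrix}T_0&B\\0&T_0^{\mathrm T}\end{bmatrix}$$ with $T_0\in\mathbf{M}_N(\mathbb{C})$ upper triangular and $B\in\mathbf{M}_N(\mathbb{C})$. *)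

theory Defs
  imports "HOL-Analysis.Analysis"
begin

text \<open>
  An \<open>n \<times> n\<close> matrix with \<open>n = 2 N\<close> is a matrix indexed by the sum type \<open>'n + 'n\<close>, where
  \<open>CARD('n) = N\<close>: the tag \<open>Inl\<close> selects the first \<open>N\<close> indices and \<open>Inr\<close> the last \<open>N\<close>.
  The linear order on \<open>'n\<close> plays the role of the usual order on \<open>{1..N}\<close>; it is only needed for
  triangularity of \<open>N \<times> N\<close> blocks.
\<close>

type_synonym 'n cblock = "complex ^ 'n ^ 'n"
type_synonym 'n cmat2 = "complex ^ ('n + 'n) ^ ('n + 'n)"

definition block_matrix ::
  "'n::finite cblock \<Rightarrow> 'n cblock \<Rightarrow> 'n cblock \<Rightarrow> 'n cblock \<Rightarrow> 'n cmat2" where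
  "block_matrix A B C D = (\<chi> i j.
     case i of
       Inl a \<Rightarrow> (case j of Inl b \<Rightarrow> A $ a $ b | Inr b \<Rightarrow> B $ a $ b)
     | Inr a \<Rightarrow> (case j of Inl b \<Rightarrow> C $ a $ b | Inr b \<Rightarrow> D $ a $ b))"

definition block11 :: "'n::finite cmat2 \<Rightarrow> 'n cblock" where
  "block11 X = (\<chi> a b. X $ Inl a $ Inl b)"

definition block12 :: "'n::finite cmat2 \<Rightarrow> 'n cblock" where
  "block12 X = (\<chi> a b. X $ Inl a $ Inr b)"

definition block21 :: "'n::finite cmat2 \<Rightarrow> 'n cblock" where
  "block21 X = (\<chi> a b. X $ Inr a $ Inl b)"

definition block22 :: "'n::finite cmat2 \<Rightarrow> 'n cblock" where
  "block22 X = (\<chi> a b. X $ Inr a $ Inr b)"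

definition dual :: "'n::finite cmat2 \<Rightarrow> 'n cmat2" where
  "dual X = block_matrix (transpose (block22 X)) (- transpose (block12 X))
                         (- transpose (block21 X)) (transpose (block11 X))"

definition J_skew_symmetric :: "'n::finite cmat2 \<Rightarrow> bool" where
  "J_skew_symmetric X \<longleftrightarrow> dual X = X"

definition conj_transpose :: "complex ^ 'n ^ 'm \<Rightarrow> complex ^ 'm ^ 'n" where
  "conj_transpose A = (\<chi> i j. cnj (A $ j $ i))"

definition unitary_matrix :: "complex ^ 'n ^ 'n \<Rightarrow> bool" where
  "unitary_matrix Q \<longleftrightarrow> conj_transpose Q ** Q = mat 1 \<and> Q ** conj_transpose Q = mat 1"

definition upper_triangular_matrix :: "'n::{finite,linorder} cblock \<Rightarrow> bool" where
  "upper_triangular_matrix A \<longleftrightarrow> (\<forall>i j. j < i \<longrightarrow> A $ i $ j = 0)"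

text \<open>
  The norm on \<open>complex ^ 'n\<close> is the Euclidean one, so this is the usual operator norm; the zero
  vector, which \<^const>\<open>onorm\<close> includes in its supremum, only contributes \<open>0 / 0 = 0\<close>.
\<close>

abbreviation op_norm :: "complex ^ 'n ^ 'm \<Rightarrow> real" where
  "op_norm A \<equiv> onorm ((*v) A)"

definition J_skew_symmetric_Schur ::
  "'n::{finite,linorder} cmat2 \<Rightarrow> 'n cmat2 \<Rightarrow> 'n cmat2 \<Rightarrow> bool" where
  "J_skew_symmetric_Schur X Q T \<longleftrightarrow>
     unitary_matrix Q \<and> dual Q = conj_transpose Q \<and> X = Q ** T ** conj_transpose Q \<and>
     (\<exists>T0 B. upper_triangular_matrix T0 \<and> T = block_matrix T0 B 0 (transpose T0))"

lemma block_matrix_sel [simp]: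
  "block11 (block_matrix A B C D) = A" "block12 (block_matrix A B C D) = B"
  "block21 (block_matrix A B C D) = C" "block22 (block_matrix A B C D) = D"
  by (simp_all add: block_matrix_def block11_def block12_def block21_def block22_def vec_eq_iff)

lemma block_matrix_collapse [simp]:
  "block_matrix (block11 X) (block12 X) (block21 X) (block22 X) = X"
  by (simp add: block_matrix_def block11_def block12_def block21_def block22_def vec_eq_iff
      split: sum.split)

lemma dual_block_matrix:
  "dual (block_matrix A B C D) =
     block_matrix (transpose D) (- transpose B) (- transpose C) (transpose A)"
  by (simp add: dual_def)

lemma block_matrix_mult:
  "block_matrix A B C D ** block_matrix A' B' C' D' =
     block_matrix (A ** A' + B ** C') (A ** B' + B ** D') (C ** A' + D ** C') (C ** B' + D ** D')"
  by (simp add: block_matrix_def matrix_matrix_mult_def vec_eq_iff UNIV_Plus_UNIV [symmetric]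
      sum.Plus del: UNIV_Plus_UNIV split: sum.split)

lemma transpose_block_matrix:
  "transpose (block_matrix A B C D) =
     block_matrix (transpose A) (transpose C) (transpose B) (transpose D)"
  by (simp add: block_matrix_def transpose_def vec_eq_iff split: sum.split)

lemma uminus_block_matrix:
  "- block_matrix A B C D = block_matrix (- A) (- B) (- C) (- D)"
  by (simp add: block_matrix_def vec_eq_iff split: sum.split)

definition J_matrix :: "'n::finite cmat2" where
  "J_matrix = block_matrix 0 (mat 1) (- mat 1) 0"

lemma matrix_neg_one_mult:
  fixes A :: "'n::finite cblock"
  shows "- mat 1 ** A = - A" "A ** - mat 1 = - A"
  by (simp_all add: matrix_matrix_mult_def mat_def vec_eq_iff if_distrib if_distribR sum_negf
      cong: if_cong)

lemma dual_eq_J_conj: "dual X = - (J_matrix ** transpose X ** J_matrix)"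
proof -
  have "dual (block_matrix A B C D) =
      - (J_matrix ** transpose (block_matrix A B C D) ** J_matrix)" for A B C D :: "'a cblock"
    by (simp add: J_matrix_def dual_block_matrix transpose_block_matrix block_matrix_mult
        uminus_block_matrix matrix_neg_one_mult)
  from this [of "block11 X" "block12 X" "block21 X" "block22 X"] show ?thesis by simp
qed

end

theory Submission
  imports Defs
begin

text \<open>
  Write \<open>P\<close> for the conjugate transpose of the inverse of \<open>U\<close>. A Newton step replaces \<open>U\<close> by
  \<open>Y = (U + P) / 2\<close>, and the defect \<open>A = (U - P) / 2\<close> satisfies \<open>Y\<^sup>* Y = 1 + A\<^sup>* A\<close>. Hence after
  a step inverses are contractions, and with \<open>e\<close> the norm of \<open>U\<^sup>* U - 1\<close> two steps give
  \<open>\<parallel>V\<^sup>* - V\<^sup>-\<^sup>1\<parallel> \<le> e\<^sup>4 / 4\<close>, while \<open>U - V\<close> is of order \<open>e\<close>. After reordering the basis \<open>T\<close> is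
  upper triangular and so is its inverse, so all of \<open>T - D\<close> is visible in \<open>T\<^sup>* - T\<^sup>-\<^sup>1\<close>: the
  Frobenius norm of \<open>T - D\<close> is at most that of \<open>T\<^sup>* - T\<^sup>-\<^sup>1\<close>, which is at most \<open>sqrt n\<close> times
  the operator norm of \<open>V\<^sup>* - V\<^sup>-\<^sup>1\<close>.
\<close>

lemma matrix_scaleR_vector:
  fixes A :: "complex ^ 'n ^ 'm"
  shows "(c *\<^sub>R A) *v x = c *\<^sub>R (A *v x)"
  by (simp add: vec_eq_iff matrix_vector_mult_def scaleR_sum_right)

lemma matrix_vector_scaleR:
  fixes A :: "complex ^ 'n ^ 'm"
  shows "A *v (c *\<^sub>R x) = c *\<^sub>R (A *v x)"
  by (simp add: vec_eq_iff matrix_vector_mult_def scaleR_sum_right)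

subsection \<open>The conjugate transpose and the operator norm\<close>

text \<open>The inner product on \<open>complex ^ 'n\<close> is the real part of the Hermitian one; this suffices to
  characterise the conjugate transpose as an adjoint.\<close>

lemma inner_conj_transpose:
  fixes A :: "complex ^ 'n::finite ^ 'm::finite"
  shows "(conj_transpose A *v x) \<bullet> y = x \<bullet> (A *v y)"
proof -
  have c: "(cnj a * u) \<bullet> v = u \<bullet> (a * v)" for a u v :: complex
    by (simp add: inner_complex_def algebra_simps)
  have "(conj_transpose A *v x) \<bullet> y = (\<Sum>i\<in>UNIV. \<Sum>j\<in>UNIV. x $ j \<bullet> (A $ j $ i * y $ i))"
    by (simp add: inner_vec_def matrix_vector_mult_def conj_transpose_def inner_sum_left c)
  also have "\<dots> = (\<Sum>j\<in>UNIV. \<Sum>i\<in>UNIV. x $ j \<bullet> (A $ j $ i * y $ i))"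
    by (rule sum.swap)
  also have "\<dots> = x \<bullet> (A *v y)"
    by (simp add: inner_vec_def matrix_vector_mult_def inner_sum_right)
  finally show ?thesis .
qed

lemma conj_transpose_conj_transpose [simp]: "conj_transpose (conj_transpose A) = A"
  by (simp add: conj_transpose_def vec_eq_iff)

lemma conj_transpose_mult:
  fixes A :: "complex ^ 'n::finite ^ 'm::finite" and B :: "complex ^ 'k::finite ^ 'n"
  shows "conj_transpose (A ** B) = conj_transpose B ** conj_transpose A"
  by (simp add: conj_transpose_def matrix_matrix_mult_def vec_eq_iff mult.commute)

lemma conj_transpose_mat_1 [simp]: "conj_transpose (mat 1) = mat 1"
  by (simp add: conj_transpose_def mat_def vec_eq_iff)

lemma norm_matrix_vector_le_op_norm:
  fixes A :: "complex ^ 'n::finite ^ 'm::finite"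
  shows "norm (A *v x) \<le> op_norm A * norm x"
  by (rule onorm) simp

text \<open>Pairing \<open>conj_transpose A *v x\<close> with itself moves \<open>A\<close> to the
  other side, where Cauchy-Schwarz applies; one factor then cancels.\<close>

lemma norm_conj_transpose_le:
  fixes A :: "complex ^ 'n::finite ^ 'm::finite"
  assumes "\<And>x. norm (A *v x) \<le> c * norm x"
  shows "norm (conj_transpose A *v x) \<le> c * norm x"
proof -
  let ?y = "conj_transpose A *v x"
  have "norm ?y * norm ?y = x \<bullet> (A *v ?y)"
    by (metis inner_conj_transpose power2_norm_eq_inner power2_eq_square)
  also have "\<dots> \<le> norm x * norm (A *v ?y)" by (rule norm_cauchy_schwarz)
  also have "\<dots> \<le> norm x * (c * norm ?y)" by (intro mult_left_mono assms norm_ge_zero)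
  finally have "norm ?y * norm ?y \<le> (c * norm x) * norm ?y" by (simp add: mult_ac)
  moreover have "0 \<le> c" using order_trans [OF norm_ge_zero assms [of "axis undefined 1"]] by simp
  ultimately show ?thesis
    by (cases "norm ?y = 0") (auto simp: mult_le_cancel_right)
qed

lemma norm_unitary_matrix:
  fixes Q :: "complex ^ 'n::finite ^ 'n"
  assumes "unitary_matrix Q"
  shows "norm (Q *v x) = norm x" "norm (conj_transpose Q *v x) = norm x"
proof -
  have "(Q *v x) \<bullet> (Q *v x) = x \<bullet> x"
    using assms by (simp add: unitary_matrix_def matrix_vector_mul_assoc flip: inner_conj_transpose)
  moreover have "(conj_transpose Q *v x) \<bullet> (conj_transpose Q *v x) = x \<bullet> x"
    using assms by (simp add: unitary_matrix_def matrix_vector_mul_assoc inner_conj_transpose)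
  ultimately show "norm (Q *v x) = norm x" "norm (conj_transpose Q *v x) = norm x"
    by (simp_all add: norm_eq)
qed

lemma norm_matrix_power2:
  fixes A :: "complex ^ 'n::finite ^ 'm::finite"
  shows "(norm A)\<^sup>2 = (\<Sum>i\<in>UNIV. \<Sum>j\<in>UNIV. (cmod (A $ i $ j))\<^sup>2)"
  by (simp add: norm_vec_def L2_set_def sum_nonneg)

lemma op_norm_le_norm:
  fixes A :: "complex ^ 'n::finite ^ 'm::finite"
  shows "op_norm A \<le> norm A"
proof (rule onorm_le)
  fix x
  have "norm ((A *v x) $ i) \<le> norm (A $ i) * norm x" for i
  proof -
    have "norm ((A *v x) $ i) \<le> (\<Sum>j\<in>UNIV. \<bar>cmod (A $ i $ j)\<bar> * \<bar>cmod (x $ j)\<bar>)"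
      unfolding matrix_vector_mult_def by (simp add: sum_norm_le norm_mult)
    also have "\<dots> \<le> norm (A $ i) * norm x"
      unfolding norm_vec_def by (rule L2_set_mult_ineq)
    finally show ?thesis .
  qed
  then have "norm (A *v x) \<le> L2_set (\<lambda>i. norm (A $ i) * norm x) UNIV"
    unfolding norm_vec_def [of "A *v x"] by (intro L2_set_mono) auto
  also have "\<dots> = norm A * norm x"
    by (simp add: norm_vec_def [of A] L2_set_left_distrib)
  finally show "norm (A *v x) \<le> norm A * norm x" .
qed

text \<open>Each column is the image of a unit vector, so it has norm at most \<open>c\<close>;
  squares are summed over the columns.\<close>

lemma norm_matrix_le_op_bound:
  fixes A :: "complex ^ 'n::finite ^ 'm::finite"
  assumes "\<And>x. norm (A *v x) \<le> c * norm x"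
  shows "norm A \<le> sqrt (real CARD('n)) * c"
proof -
  have c: "0 \<le> c"
    using order_trans [OF norm_ge_zero assms [of "axis undefined 1"]] by simp
  have "(norm A)\<^sup>2 = (\<Sum>j\<in>UNIV. (norm (A *v axis j 1))\<^sup>2)"
    unfolding norm_matrix_power2
    by (subst sum.swap)
      (simp add: matrix_vector_mult_def axis_def if_distrib norm_vec_def L2_set_def sum_nonneg
        cong: if_cong)
  also have "\<dots> \<le> (\<Sum>j\<in>(UNIV::'n set). c\<^sup>2)"
    by (rule sum_mono, rule power_mono) (use assms [of "axis _ 1"] in auto)
  also have "\<dots> = (sqrt (real CARD('n)) * c)\<^sup>2"
    by (simp add: power_mult_distrib)
  finally show ?thesis
    using c by (simp add: power2_le_iff_abs_le)
qed

subsection \<open>Triangular matrices that are nearly unitary\<close>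

text \<open>Column \<open>j\<close> of \<open>N ** M = mat 1\<close> gives \<open>N $ i $ j * M $ j $ j = mat 1 $ i $ j\<close> for \<open>i\<close> of
  rank at least that of \<open>j\<close>, once the columns of smaller rank are known to be triangular.\<close>

lemma triangular_left_inverse:
  fixes M N :: "complex ^ 'k::finite ^ 'k" and r :: "'k \<Rightarrow> 'o::wellorder"
  assumes r: "inj r" and M: "\<And>i j. r j < r i \<Longrightarrow> M $ i $ j = 0"
    and inv: "N ** M = mat 1"
  shows "N $ j $ j * M $ j $ j = 1" "r j < r i \<Longrightarrow> N $ i $ j = 0"
proof -
  have "N $ j $ j * M $ j $ j = 1 \<and> (\<forall>i. r j < r i \<longrightarrow> N $ i $ j = 0)"
  proof (induction "r j" arbitrary: j rule: less_induct)
    case less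
    have eq: "N $ i $ j * M $ j $ j = (if i = j then 1 else 0)" if "r j \<le> r i" for i
    proof -
      have "N $ i $ k * M $ k $ j = 0" if "k \<noteq> j" for k
      proof (cases "r k < r j")
        case True
        then show ?thesis using less \<open>r j \<le> r i\<close> by fastforce
      next
        case False
        then have "r j < r k" using that r by (metis injD linorder_neqE)
        then show ?thesis by (simp add: M)
      qed
      then have "(N ** M) $ i $ j = N $ i $ j * M $ j $ j"
        unfolding matrix_matrix_mult_def
        by (simp add: sum.remove [of UNIV j] sum.neutral del: mult_eq_0_iff)
      then show ?thesis by (simp add: inv mat_def)
    qed
    from eq [of j] have 1: "N $ j $ j * M $ j $ j = 1" by simp
    then have "M $ j $ j \<noteq> 0" by auto
    then have "N $ i $ j = 0" if "r j < r i" for i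
      using eq [of i] that by (cases "i = j") auto
    with 1 show ?case by blast
  qed
  then show "N $ j $ j * M $ j $ j = 1" "r j < r i \<Longrightarrow> N $ i $ j = 0" by blast+
qed

text \<open>Off the diagonal, one of \<open>conj_transpose T\<close> and its approximation \<open>N\<close> vanishes, so the
  difference of the two already contains all of \<open>T - D\<close>.\<close>

lemma norm_triangular_minus_phases_le:
  fixes T N D :: "complex ^ 'k::finite ^ 'k" and r :: "'k \<Rightarrow> 'o::wellorder"
  assumes r: "inj r" and T: "\<And>i j. r j < r i \<Longrightarrow> T $ i $ j = 0"
    and inv: "N ** T = mat 1"
    and D: "D = (\<chi> i j. if i = j then complex_of_real (1 / cmod (T $ j $ j)) * T $ j $ j else 0)"
  shows "norm (T - D) \<le> norm (conj_transpose T - N)"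
proof -
  let ?F = "conj_transpose T - N"
  note tri = triangular_left_inverse [OF r T inv]
  have entry: "cmod ((T - D) $ i $ j) \<le> cmod (?F $ j $ i)" for i j
  proof (cases "i = j")
    case True
    let ?t = "T $ j $ j"
    have t: "?t \<noteq> 0" using tri(1) [of j] by auto
    then have N: "N $ j $ j = 1 / ?t" using tri(1) [of j] by (simp add: field_simps)
    have "(T - D) $ j $ j = complex_of_real (1 - 1 / cmod ?t) * ?t"
      by (simp add: D algebra_simps)
    then have "cmod ((T - D) $ j $ j) = \<bar>1 - 1 / cmod ?t\<bar> * cmod ?t"
      by (simp only: norm_mult norm_of_real)
    also have "\<dots> = \<bar>cmod ?t - 1\<bar>"
      using t by (simp add: abs_if field_simps)
    finally have l: "cmod ((T - D) $ j $ j) = \<bar>cmod ?t - 1\<bar>" .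
    \<comment> \<open>On the diagonal both sides are multiples of
      \<open>\<bar>cmod ?t - 1\<bar>\<close>; the factor \<open>(cmod ?t + 1) / cmod ?t\<close> on
      the right exceeds 1.\<close>
    have "cnj ?t - 1 / ?t = (complex_of_real ((cmod ?t)\<^sup>2 - 1)) / ?t"
      using t complex_norm_square [of ?t] by (simp add: field_simps)
    then have "cmod (?F $ j $ j) = \<bar>(cmod ?t)\<^sup>2 - 1\<bar> / cmod ?t"
      by (simp add: N conj_transpose_def norm_divide del: of_real_diff of_real_power)
    also have "(cmod ?t)\<^sup>2 - 1 = (cmod ?t - 1) * (cmod ?t + 1)"
      by (simp add: power2_eq_square algebra_simps)
    finally have "cmod (?F $ j $ j) = \<bar>cmod ?t - 1\<bar> * ((cmod ?t + 1) / cmod ?t)"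
      by (simp add: abs_mult)
    moreover have "1 \<le> (cmod ?t + 1) / cmod ?t" using t by (simp add: field_simps)
    ultimately show ?thesis
      using True l mult_left_mono [of 1 "(cmod ?t + 1) / cmod ?t" "\<bar>cmod ?t - 1\<bar>"] by simp
  next
    case False
    then consider "r i < r j" | "r j < r i" using r by (metis injD linorder_neqE)
    then show ?thesis
      by cases (use False tri(2) T in \<open>auto simp: D conj_transpose_def\<close>)
  qed
  have "(norm (T - D))\<^sup>2 \<le> (\<Sum>i\<in>UNIV. \<Sum>j\<in>UNIV. (cmod (?F $ j $ i))\<^sup>2)"
    unfolding norm_matrix_power2 by (intro sum_mono power_mono entry norm_ge_zero)
  also have "\<dots> = (norm ?F)\<^sup>2"
    unfolding norm_matrix_power2 by (rule sum.swap)
  finally show ?thesis by (simp add: power2_le_iff_abs_le)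
qed

subsection \<open>One step of the Newton iteration for the polar decomposition\<close>

text \<open>Here \<open>P\<close> is the conjugate transpose of the inverse of \<open>U\<close>.\<close>

lemma newton_step_inner:
  fixes U P :: "complex ^ 'n::finite ^ 'n"
  assumes "conj_transpose P ** U = mat 1"
  shows "((1 / 2) *\<^sub>R (U + P) *v z) \<bullet> ((1 / 2) *\<^sub>R (U + P) *v y) =
    z \<bullet> y + ((1 / 2) *\<^sub>R (U - P) *v z) \<bullet> ((1 / 2) *\<^sub>R (U - P) *v y)"
proof -
  \<comment> \<open>The cross terms of \<open>U\<close> and \<open>P\<close> are all
    \<open>z \<bullet> y\<close>, so the forms of the half sum and the half difference differ by
    exactly \<open>z \<bullet> y\<close>.\<close>
  have a: "(P *v z) \<bullet> (U *v y) = z \<bullet> y" for z y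
    using assms inner_conj_transpose [of "P" "U *v y" z]
    by (simp add: matrix_vector_mul_assoc inner_commute)
  have b: "(U *v z) \<bullet> (P *v y) = z \<bullet> y" for z y
    using a [of y z] by (simp add: inner_commute)
  show ?thesis
    by (simp add: matrix_scaleR_vector matrix_vector_mult_add_rdistrib
        matrix_vector_mult_diff_rdistrib inner_add_left inner_add_right inner_diff_left
        inner_diff_right a b algebra_simps)
qed

lemma newton_step_norm_ge:
  fixes U P :: "complex ^ 'n::finite ^ 'n"
  assumes "conj_transpose P ** U = mat 1"
  shows "norm y \<le> norm ((1 / 2) *\<^sub>R (U + P) *v y)"
  using newton_step_inner [OF assms, of y y] by (simp add: norm_le)

text \<open>With \<open>A = (U - P) / 2\<close> the vector estimated is
  \<open>conj_transpose A *v (A *v y)\<close>, so a bound on \<open>A\<close> enters squared: this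
  is the quadratic convergence.\<close>

lemma newton_step_gram_defect:
  fixes U P :: "complex ^ 'n::finite ^ 'n"
  assumes "conj_transpose P ** U = mat 1"
    and Y: "Y = (1 / 2) *\<^sub>R (U + P)"
    and a: "\<And>x. norm ((1 / 2) *\<^sub>R (U - P) *v x) \<le> a * norm x"
  shows "norm (conj_transpose Y *v (Y *v y) - y) \<le> a\<^sup>2 * norm y"
proof -
  let ?A = "(1 / 2) *\<^sub>R (U - P)"
  define z where "z = conj_transpose Y *v (Y *v y) - y"
  have "z \<bullet> z = (conj_transpose Y *v (Y *v y)) \<bullet> z - y \<bullet> z"
    by (simp add: z_def inner_diff_left)
  also have "\<dots> = (?A *v y) \<bullet> (?A *v z)"
    using newton_step_inner [OF assms(1), of y z] by (simp add: inner_conj_transpose Y)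
  also have "\<dots> \<le> norm (?A *v y) * norm (?A *v z)" by (rule norm_cauchy_schwarz)
  also have "\<dots> \<le> (a * norm y) * (a * norm z)"
    by (intro mult_mono a order_trans [OF norm_ge_zero a] norm_ge_zero)
  finally have "norm z * norm z \<le> (a\<^sup>2 * norm y) * norm z"
    by (simp add: power2_norm_eq_inner [symmetric] power2_eq_square mult_ac)
  then show ?thesis
    unfolding z_def [symmetric] by (cases "norm z = 0") (auto simp: mult_le_cancel_right)
qed

text \<open>Turns a Gram defect into a bound on the half difference, which the next step
  squares.\<close>

lemma newton_step_antihermitian_part:
  fixes U P :: "complex ^ 'n::finite ^ 'n"
  assumes "P ** conj_transpose U = mat 1"
  shows "(1 / 2) *\<^sub>R (U - P) *v x = (1 / 2) *\<^sub>R (P *v (conj_transpose U *v (U *v x) - x))"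
  using assms
  by (simp add: matrix_scaleR_vector matrix_vector_mult_diff_distrib
      matrix_vector_mult_diff_rdistrib matrix_vector_mul_assoc matrix_mul_assoc)

text \<open>A lower bound on \<open>U\<close> forces a trivial kernel, hence invertibility, and its
  reciprocal bounds the inverse and the adjoint of the inverse.\<close>

lemma conj_transpose_inverse:
  fixes U :: "complex ^ 'n::finite ^ 'n"
  assumes "0 < c" and c: "\<And>x. c * norm x \<le> norm (U *v x)"
  defines "P \<equiv> conj_transpose (matrix_inv U)"
  shows "conj_transpose P ** U = mat 1" "U ** conj_transpose P = mat 1"
    "P ** conj_transpose U = mat 1" "conj_transpose U ** P = mat 1"
    "norm (P *v x) \<le> 1 / c * norm x" "norm (conj_transpose P *v x) \<le> 1 / c * norm x"
proof -
  have "\<forall>x. U *v x = 0 \<longrightarrow> x = 0"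
    using c \<open>0 < c\<close> by (metis norm_zero norm_le_zero_iff mult_le_0_iff not_le)
  then have "\<exists>B. B ** U = mat 1" by (simp add: matrix_left_invertible_ker)
  then have "invertible U" by (simp add: invertible_left_inverse)
  then have inv: "U ** matrix_inv U = mat 1 \<and> matrix_inv U ** U = mat 1"
    unfolding matrix_inv_def invertible_def by (rule someI_ex)
  show 1: "conj_transpose P ** U = mat 1" "U ** conj_transpose P = mat 1"
    using inv by (simp_all add: P_def)
  show "P ** conj_transpose U = mat 1" "conj_transpose U ** P = mat 1"
    using inv by (simp_all add: P_def flip: conj_transpose_mult)
  have le: "norm (conj_transpose P *v x) \<le> 1 / c * norm x" for x
    using c [of "conj_transpose P *v x"] \<open>0 < c\<close>
    by (simp add: matrix_vector_mul_assoc 1 field_simps)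
  then show "norm (conj_transpose P *v x) \<le> 1 / c * norm x" .
  show "norm (P *v x) \<le> 1 / c * norm x"
    using norm_conj_transpose_le [OF le] by simp
qed

lemma conj_transpose_newton_step:
  "conj_transpose ((1 / 2) *\<^sub>R (U + P)) =
    (1 / 2) *\<^sub>R (conj_transpose U + conj_transpose P)"
  by (simp add: conj_transpose_def vec_eq_iff complex_eq_iff)

text \<open>With \<open>H = conj_transpose U ** U\<close> and \<open>E = H - mat 1\<close>, one has
  \<open>4 * conj_transpose U ** (U - V) = (3 * H + 1) * (H + 1)\<^sup>-\<^sup>1 * E\<close>. The proof writes
  \<open>x = (H + 1) y\<close>, so that with \<open>z = E y\<close> only \<open>(4 + 3 * E) z\<close> and \<open>(2 + E) z\<close> have to be
  compared.\<close>

lemma newton_two_steps_distance: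
  fixes U P P1 :: "complex ^ 'n::finite ^ 'n"
  defines "V1 \<equiv> (1 / 2) *\<^sub>R (U + P)"
  assumes P: "U ** conj_transpose P = mat 1" "P ** conj_transpose U = mat 1"
      "conj_transpose U ** P = mat 1"
    and P1: "conj_transpose V1 ** P1 = mat 1"
    and e: "e \<le> 3 / 4" "\<And>x. norm (conj_transpose U *v (U *v x) - x) \<le> e * norm x"
    and p: "0 \<le> p" "\<And>x. norm (P *v x) \<le> p * norm x"
  shows "norm ((U - (1 / 2) *\<^sub>R (V1 + P1)) *v x) \<le> p * (7 / 12 * (e * norm x))"
proof -
  define h where "h y = conj_transpose U *v (U *v y)" for y
  have h_add: "h (a + b) = h a + h b" and h_diff: "h (a - b) = h a - h b" for a b
    by (simp_all add: h_def matrix_vector_mult_diff_distrib vec.add)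
  define w where "w = (U - (1 / 2) *\<^sub>R (V1 + P1)) *v x"
  \<comment> \<open>This is \<open>(H + 1)\<^sup>-\<^sup>1 x\<close>, expressed through the inverses
    already at hand.\<close>
  define y where "y = (1 / 2) *\<^sub>R (conj_transpose P *v (P1 *v x))"
  define z where "z = h y - y"
  define g where "g = h z - z"
  have P1x: "P1 *v x = 2 *\<^sub>R (U *v y)"
    by (simp add: y_def matrix_vector_scaleR matrix_vector_mul_assoc matrix_mul_assoc P)
  have "conj_transpose P *v (P1 *v x) = 2 *\<^sub>R y" by (simp add: y_def)
  moreover have "conj_transpose U *v (P1 *v x) = 2 *\<^sub>R h y"
    by (simp add: P1x matrix_vector_scaleR h_def)
  moreover have "conj_transpose V1 *v (P1 *v x) = x"
    by (simp add: matrix_vector_mul_assoc P1)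
  ultimately have x: "x = h y + y"
    by (simp add: V1_def conj_transpose_newton_step matrix_scaleR_vector
        matrix_vector_mult_add_rdistrib flip: scaleR_add_right)
  have "w = U *v x - (1 / 4) *\<^sub>R (U *v x + P *v x) - U *v y"
    by (simp add: w_def V1_def matrix_vector_mult_diff_rdistrib matrix_scaleR_vector
        matrix_vector_mult_add_rdistrib P1x scaleR_add_right)
  then have "conj_transpose U *v w = h x - (1 / 4) *\<^sub>R (h x + x) - h y"
    by (simp add: matrix_vector_mult_diff_distrib matrix_vector_scaleR vec.add h_def
        matrix_vector_mul_assoc P)
  then have "4 *\<^sub>R (conj_transpose U *v w) = 4 *\<^sub>R (h x - (1 / 4) *\<^sub>R (h x + x) - h y)"
    by simp
  also have "\<dots> = 3 *\<^sub>R h x - x - 4 *\<^sub>R h y"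
    by (simp add: vec_eq_iff complex_eq_iff field_simps)
  also have "\<dots> = 4 *\<^sub>R z + 3 *\<^sub>R g"
    by (simp add: x g_def z_def h_add h_diff vec_eq_iff complex_eq_iff)
  finally have Uw: "4 *\<^sub>R (conj_transpose U *v w) = 4 *\<^sub>R z + 3 *\<^sub>R g" .
  have hx: "2 *\<^sub>R z + g = h x - x"
    by (simp add: x g_def z_def h_add h_diff vec_eq_iff complex_eq_iff)
  have g: "norm g \<le> 3 / 4 * norm z"
    using e(2) [of z] mult_right_mono [OF e(1) norm_ge_zero [of z]] by (simp add: g_def h_def)
  have "z \<bullet> g \<le> norm z * norm g" by (rule norm_cauchy_schwarz)
  also have "\<dots> \<le> norm z * (3 / 4 * norm z)" by (intro mult_left_mono g norm_ge_zero)
  finally have zg: "z \<bullet> g \<le> 3 / 4 * (z \<bullet> z)"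
    by (simp add: power2_norm_eq_inner [symmetric] power2_eq_square)
  have gg: "g \<bullet> g \<le> 9 / 16 * (z \<bullet> z)"
    using power_mono [OF g, of 2]
    by (simp add: power2_norm_eq_inner [symmetric] power_mult_distrib power2_eq_square)
  have "(4 *\<^sub>R z + 3 *\<^sub>R g) \<bullet> (4 *\<^sub>R z + 3 *\<^sub>R g) =
      16 * (z \<bullet> z) + 24 * (z \<bullet> g) + 9 * (g \<bullet> g)"
    by (simp add: inner_add_left inner_add_right inner_commute)
  \<comment> \<open>For \<open>0 \<le> t \<le> 3 / 4\<close> the ratio
    \<open>(4 + 3 * t) / (2 + t)\<close> is at most 25/11, which is below 7/3, and 49/9 is the
    square of 7/3. Clearing terms leaves \<open>z \<bullet> g\<close> and
    \<open>g \<bullet> g\<close> on the left only, so upper bounds for them suffice.\<close>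
  also have "\<dots> \<le> 49 / 9 * (4 * (z \<bullet> z) + 4 * (z \<bullet> g) + g \<bullet> g)"
    using zg gg inner_ge_zero [of z] by argo
  also have "\<dots> = ((7 / 3) *\<^sub>R (2 *\<^sub>R z + g)) \<bullet> ((7 / 3) *\<^sub>R (2 *\<^sub>R z + g))"
    by (simp add: inner_add_left inner_add_right inner_commute)
  finally have "norm (4 *\<^sub>R z + 3 *\<^sub>R g) \<le> norm ((7 / 3) *\<^sub>R (2 *\<^sub>R z + g))"
    by (simp only: norm_le)
  then have "4 * norm (conj_transpose U *v w) \<le> 7 / 3 * norm (h x - x)"
    by (simp flip: Uw hx)
  then have *: "norm (conj_transpose U *v w) \<le> 7 / 12 * (e * norm x)"
    using e(2) [of x] by (simp add: h_def)
  have "norm w = norm (P *v (conj_transpose U *v w))"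
    by (simp add: matrix_vector_mul_assoc P)
  also have "\<dots> \<le> p * norm (conj_transpose U *v w)" by (rule p)
  also have "\<dots> \<le> p * (7 / 12 * (e * norm x))" using * p(1) by (rule mult_left_mono)
  finally show ?thesis by (simp add: w_def)
qed

text \<open>The defect gives the squared lower bound \<open>1 - e\<close>;
  \<open>1 + 4 / 3 * e\<close> is the chord of the convex function \<open>1 / sqrt (1 - e)\<close>
  between 0 and 3/4.\<close>

lemma norm_ge_of_gram_defect:
  fixes U :: "complex ^ 'n::finite ^ 'n"
  assumes "0 \<le> e" "e \<le> 3 / 4"
    and e: "norm (conj_transpose U *v (U *v x) - x) \<le> e * norm x"
  shows "1 / (1 + 4 / 3 * e) * norm x \<le> norm (U *v x)"
proof -
  let ?c = "1 / (1 + 4 / 3 * e)"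
  let ?d = "conj_transpose U *v (U *v x) - x"
  have "- (x \<bullet> ?d) \<le> norm x * norm ?d"
    using norm_cauchy_schwarz [of "- x" ?d] by simp
  also have "\<dots> \<le> norm x * (e * norm x)" by (intro mult_left_mono e norm_ge_zero)
  finally have "(1 - e) * (norm x)\<^sup>2 \<le> x \<bullet> x + x \<bullet> ?d"
    by (simp add: power2_norm_eq_inner [symmetric] power2_eq_square algebra_simps)
  also have "\<dots> = (norm (U *v x))\<^sup>2"
    using inner_conj_transpose [of U "U *v x" x]
    by (simp add: inner_diff_right power2_norm_eq_inner inner_commute)
  finally have 1: "(1 - e) * (norm x)\<^sup>2 \<le> (norm (U *v x))\<^sup>2" .
  have "0 \<le> e * ((3 - 4 * e) * (5 + 4 * e))"
    using assms by (intro mult_nonneg_nonneg) auto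
  moreover have "(1 - e) * (1 + 4 / 3 * e)\<^sup>2 = 1 + e * ((3 - 4 * e) * (5 + 4 * e)) / 9"
    by (simp add: power2_eq_square field_simps)
  ultimately have "1 \<le> (1 - e) * (1 + 4 / 3 * e)\<^sup>2" by simp
  then have "?c\<^sup>2 \<le> 1 - e"
    using assms by (simp add: power_divide field_simps)
  then have "(?c * norm x)\<^sup>2 \<le> (norm (U *v x))\<^sup>2"
    using 1 mult_right_mono [of "?c\<^sup>2" "1 - e" "(norm x)\<^sup>2"]
    by (simp only: power_mult_distrib) simp
  then show ?thesis by (rule power2_le_imp_le) simp
qed

subsection \<open>Schur decompositions\<close>

text \<open>The lower right block of a Schur factor is lower triangular: its indices have to be ranked in
  decreasing order.\<close>

lemma Schur_triangular:
  fixes T :: "'n::{finite,linorder} cmat2"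
  assumes "upper_triangular_matrix T0" and "T = block_matrix T0 B 0 (transpose T0)"
  obtains r :: "'n + 'n \<Rightarrow> nat" where "inj r" "\<And>i j. r j < r i \<Longrightarrow> T $ i $ j = 0"
proof -
  define d where "d a = card {b. b < a}" for a :: 'n
  define N where "N = CARD('n)"
  have mono: "d a < d b \<longleftrightarrow> a < b" for a b
  proof -
    have "d a < d b" if "a < b" for a b
      unfolding d_def using that by (intro psubset_card_mono) auto
    then show ?thesis by (metis less_asym linorder_neqE)
  qed
  have d: "d a < N" for a
    unfolding d_def N_def by (intro psubset_card_mono) auto
  have inj: "d a = d b \<longleftrightarrow> a = b" for a b
    using mono by (metis less_irrefl linorder_neqE)
  \<comment> \<open>The first block gets ranks below \<open>N\<close>, the second ranks above
    \<open>N\<close> in reverse, so the zero block lies below the diagonal.\<close>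
  define r where "r = case_sum d (\<lambda>a. 2 * N - d a)"
  have less: "d a < 2 * N - d b" for a b using d [of a] d [of b] by linarith
  have not_less: "\<not> 2 * N - d b < d a" for a b using less [of a b] by simp
  have rev: "2 * N - d a < 2 * N - d b \<longleftrightarrow> b < a" "2 * N - d a = 2 * N - d b \<longleftrightarrow> a = b" for a b
    using d [of a] d [of b] mono [of b a] inj [of a b] by auto
  show thesis
  proof
    show "inj r"
      using less by (auto simp: inj_on_def r_def inj rev dest: less_imp_neq split: sum.splits)
        (metis less_irrefl)+
    show "T $ i $ j = 0" if "r j < r i" for i j
      using that assms
      by (auto simp: r_def block_matrix_def transpose_def upper_triangular_matrix_def mono rev
          not_less split: sum.splits)
  qed
qed

section \<open>Diagonal matrices\<close>

lemma diagonal_matrix_mult: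
  fixes a b :: "'n::finite \<Rightarrow> complex"
  shows "(\<chi> i j. if i = j then a j else 0) ** (\<chi> i j. if i = j then b j else 0) =
    ((\<chi> i j. if i = j then a j * b j else 0) :: complex ^ 'n ^ 'n)"
proof -
  have "(\<Sum>k\<in>UNIV. (if i = k then a k else 0) * (if k = j then b j else 0)) =
      (\<Sum>k\<in>UNIV. if i = k then a i * (if i = j then b j else 0) else 0)" for i j
    by (rule sum.cong) auto
  then show ?thesis by (simp add: matrix_matrix_mult_def vec_eq_iff)
qed

lemma unitary_diagonal_matrix:
  fixes d :: "'n::finite \<Rightarrow> complex"
  assumes "\<And>i. cmod (d i) = 1" and D: "D = (\<chi> i j. if i = j then d j else 0)"
  shows "unitary_matrix D"
proof -
  have 1: "cnj (d i) * d i = 1" "d i * cnj (d i) = 1" for i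
    using assms(1) [of i] complex_norm_square [of "d i"] by (simp_all add: mult.commute)
  have "conj_transpose D = (\<chi> i j. if i = j then cnj (d j) else 0)"
    by (simp add: D conj_transpose_def vec_eq_iff)
  then show ?thesis
    by (simp only: unitary_matrix_def D diagonal_matrix_mult 1) (simp add: mat_def)
qed

text \<open>The dual swaps the two diagonal blocks, and transposing them leaves a diagonal matrix
  unchanged.\<close>

lemma J_skew_symmetric_diagonal_matrix:
  fixes d :: "'n::finite + 'n \<Rightarrow> complex"
  assumes "\<And>a. d (Inr a) = d (Inl a)" and "D = (\<chi> i j. if i = j then d j else 0)"
  shows "J_skew_symmetric D"
  using assms
  by (simp add: J_skew_symmetric_def dual_def block_matrix_def block11_def block12_def block21_def
      block22_def transpose_def vec_eq_iff split: sum.split)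

theorem theorem13:
  fixes U V1 V Q T D :: "'n::{finite,linorder} cmat2"
  assumes "J_skew_symmetric U"
    and "op_norm (conj_transpose U ** U - mat 1) \<le> 3 / 4"
    and "V1 = (1 / 2) *\<^sub>R (U + conj_transpose (matrix_inv U))"
    and "V = (1 / 2) *\<^sub>R (V1 + conj_transpose (matrix_inv V1))"
    and "J_skew_symmetric_Schur V Q T"
    and "D = (\<chi> i j. if i = j then complex_of_real (1 / cmod (T $ j $ j)) * T $ j $ j else 0)"
  shows "unitary_matrix D \<and> J_skew_symmetric D \<and>
    op_norm (U - Q ** D ** conj_transpose Q) \<le>
      7 / 10 * sqrt (real CARD('n + 'n)) * (op_norm (conj_transpose U ** U - mat 1))\<^sup>2
      + 7 / 10 * op_norm (conj_transpose U ** U - mat 1)"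
proof -

  \<comment> \<open>Bounds for the two Newton iterates\<close>
  define e where "e = op_norm (conj_transpose U ** U - mat 1)"
  define P where "P = conj_transpose (matrix_inv U)"
  define P1 where "P1 = conj_transpose (matrix_inv V1)"
  define W where "W = matrix_inv V"
  have e0: "0 \<le> e" unfolding e_def by (rule onorm_pos_le) simp
  have e1: "e \<le> 3 / 4" using assms(2) by (simp add: e_def)
  have E: "norm (conj_transpose U *v (U *v x) - x) \<le> e * norm x" for x
    using norm_matrix_vector_le_op_norm [of "conj_transpose U ** U - mat 1" x]
    by (simp add: e_def matrix_vector_mult_diff_rdistrib matrix_vector_mul_assoc)
  define p where "p = 1 + 4 / 3 * e"
  have p: "0 < p" "p \<le> 2" using e0 e1 by (simp_all add: p_def)
  note invU = conj_transpose_inverse [of "1 / p" U, folded P_def]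
  have U_ge: "1 / p * norm x \<le> norm (U *v x)" for x
    unfolding p_def by (rule norm_ge_of_gram_defect [OF e0 e1 E])
  have P: "conj_transpose P ** U = mat 1" "U ** conj_transpose P = mat 1"
    "P ** conj_transpose U = mat 1" "conj_transpose U ** P = mat 1"
    and Ple: "norm (P *v x) \<le> p * norm x" for x
    using invU(1-5) [OF _ U_ge] p by simp_all
  have V1: "V1 = (1 / 2) *\<^sub>R (U + P)" using assms(3) by (simp add: P_def)
  have V1_ge: "1 * norm x \<le> norm (V1 *v x)" for x
    using newton_step_norm_ge [OF P(1)] by (simp add: V1)
  note P1 = conj_transpose_inverse [OF zero_less_one V1_ge, folded P1_def]
  have V: "V = (1 / 2) *\<^sub>R (V1 + P1)" using assms(4) by (simp add: P1_def)
  have V_ge: "1 * norm x \<le> norm (V *v x)" for x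
    using newton_step_norm_ge [OF P1(1)] by (simp add: V)
  note W = conj_transpose_inverse [OF zero_less_one V_ge, unfolded conj_transpose_conj_transpose,
      folded W_def]

  have A: "norm ((1 / 2) *\<^sub>R (U - P) *v x) \<le> e * norm x" for x
  proof -
    have "norm (P *v (conj_transpose U *v (U *v x) - x)) \<le> p * (e * norm x)"
      by (rule order_trans [OF Ple]) (use p in \<open>simp add: E\<close>)
    \<comment> \<open>The bound 2 on \<open>p\<close> cancels the factor 1/2 of the half
      difference.\<close>
    also have "\<dots> \<le> 2 * (e * norm x)"
      using p e0 by (intro mult_right_mono) auto
    finally show ?thesis
      by (simp add: newton_step_antihermitian_part [OF P(3)])
  qed
  \<comment> \<open>The Gram defect of \<open>V1\<close> is at most \<open>e\<^sup>2\<close>,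
    \<open>P1\<close> is a contraction, and the half difference contributes 1/2.\<close>
  have A1: "norm ((1 / 2) *\<^sub>R (V1 - P1) *v x) \<le> e\<^sup>2 / 2 * norm x" for x
    using order_trans [OF P1(5) newton_step_gram_defect [OF P(1) V1 A, THEN mult_left_mono]]
    by (simp add: newton_step_antihermitian_part [OF P1(3)])
  \<comment> \<open>Since \<open>V ** W = mat 1\<close>, the difference is the Gram defect of
    \<open>V\<close> applied after the contraction \<open>W\<close>.\<close>
  have VW: "norm ((conj_transpose V - W) *v x) \<le> (e\<^sup>2 / 2)\<^sup>2 * norm x" for x
  proof -
    have "x = V *v (W *v x)" by (simp add: matrix_vector_mul_assoc W)
    then have "norm ((conj_transpose V - W) *v x) =
        norm (conj_transpose V *v (V *v (W *v x)) - W *v x)"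
      by (simp add: matrix_vector_mult_diff_rdistrib)
    also have "\<dots> \<le> (e\<^sup>2 / 2)\<^sup>2 * norm (W *v x)"
      by (rule newton_step_gram_defect [OF P1(1) V A1])
    also have "\<dots> \<le> (e\<^sup>2 / 2)\<^sup>2 * norm x"
      using W(6) [of x] by (intro mult_left_mono) auto
    finally show ?thesis .
  qed

  \<comment> \<open>Passage to the Schur form\<close>
  obtain T0 B where Q: "unitary_matrix Q" and VT: "V = Q ** T ** conj_transpose Q"
    and T0: "upper_triangular_matrix T0" and T: "T = block_matrix T0 B 0 (transpose T0)"
    using assms(5) by (auto simp: J_skew_symmetric_Schur_def)
  have QQ: "conj_transpose Q ** Q = mat 1" "Q ** conj_transpose Q = mat 1"
    using Q by (auto simp: unitary_matrix_def)
  obtain r :: "'n + 'n \<Rightarrow> nat" where r: "inj r" "\<And>i j. r j < r i \<Longrightarrow> T $ i $ j = 0"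
    using Schur_triangular [OF T0 T] by metis
  define N where "N = conj_transpose Q ** W ** Q"
  have TV: "T = conj_transpose Q ** V ** Q"
    by (metis QQ(1) VT matrix_mul_assoc matrix_mul_lid matrix_mul_rid)
  have NT: "N ** T = mat 1"
    unfolding N_def TV by (metis QQ W(1) matrix_mul_assoc matrix_mul_rid)
  have "norm ((conj_transpose T - N) *v x) \<le> (e\<^sup>2 / 2)\<^sup>2 * norm x" for x
  proof -
    have "(conj_transpose T - N) *v x = conj_transpose Q *v ((conj_transpose V - W) *v (Q *v x))"
      by (simp add: TV N_def conj_transpose_mult matrix_vector_mult_diff_rdistrib
          matrix_vector_mult_diff_distrib flip: matrix_vector_mul_assoc)
    then show ?thesis using VW [of "Q *v x"] by (simp add: norm_unitary_matrix [OF Q])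
  qed
  then have "norm (conj_transpose T - N) \<le> sqrt (real CARD('n + 'n)) * (e\<^sup>2 / 2)\<^sup>2"
    by (rule norm_matrix_le_op_bound)
  with op_norm_le_norm [of "T - D"] norm_triangular_minus_phases_le [OF r NT assms(6)]
  have TD: "op_norm (T - D) \<le> sqrt (real CARD('n + 'n)) * (e\<^sup>2 / 2)\<^sup>2" by linarith

  \<comment> \<open>The error estimate\<close>
  have "norm ((U - Q ** D ** conj_transpose Q) *v x) \<le>
      (p * (7 / 12 * e) + sqrt (real CARD('n + 'n)) * (e\<^sup>2 / 2)\<^sup>2) * norm x" for x
  proof -
    let ?y = "conj_transpose Q *v x"
    have "(U - Q ** D ** conj_transpose Q) *v x = (U - V) *v x + Q *v ((T - D) *v ?y)"
      by (simp add: VT matrix_vector_mult_diff_rdistrib matrix_vector_mult_diff_distrib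
          flip: matrix_vector_mul_assoc)
    then have "norm ((U - Q ** D ** conj_transpose Q) *v x) \<le>
        norm ((U - V) *v x) + norm ((T - D) *v ?y)"
      by (metis norm_triangle_ineq norm_unitary_matrix(1) [OF Q])
    moreover have "norm ((U - V) *v x) \<le> p * (7 / 12 * (e * norm x))"
      using newton_two_steps_distance [OF P(2-4) P1(4) [unfolded V1] e1 E _ Ple] p
      by (simp add: V V1)
    moreover have "norm ((T - D) *v ?y) \<le> op_norm (T - D) * norm x"
      using norm_matrix_vector_le_op_norm [of "T - D" ?y] by (simp add: norm_unitary_matrix [OF Q])
    moreover have "\<dots> \<le> sqrt (real CARD('n + 'n)) * (e\<^sup>2 / 2)\<^sup>2 * norm x"
      by (intro mult_right_mono TD norm_ge_zero)
    ultimately show ?thesis by (simp add: algebra_simps)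
  qed
  then have "op_norm (U - Q ** D ** conj_transpose Q) \<le>
      p * (7 / 12 * e) + sqrt (real CARD('n + 'n)) * (e\<^sup>2 / 2)\<^sup>2"
    by (rule onorm_le)
  also have "\<dots> \<le> 7 / 10 * sqrt (real CARD('n + 'n)) * e\<^sup>2 + 7 / 10 * e"
  proof -
    define s where "s = sqrt (real CARD('n + 'n))"
    \<comment> \<open>As \<open>n\<close> is at least 2, \<open>s \<ge> 141 / 100\<close>, which
      lets the \<open>s * e\<^sup>2\<close> term absorb the stray \<open>7 / 9 * e\<^sup>2\<close>:
      7/9 divided by 1.41, plus 9/64, stays below 7/10.\<close>
    have "2 \<le> CARD('n + 'n)" using zero_less_card_finite [where 'a = 'n] by (simp del: zero_less_card_finite)
    then have s: "141 / 100 \<le> s"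
      unfolding s_def by (intro real_le_rsqrt) (simp add: power2_eq_square)
    have e2: "e\<^sup>2 \<le> 9 / 16" using power_mono [OF e1 e0, of 2] by (simp add: power2_eq_square)
    have "s * (e\<^sup>2 / 2)\<^sup>2 = (s * e\<^sup>2) * (e\<^sup>2 / 4)" by (simp add: power2_eq_square)
    also have "\<dots> \<le> (s * e\<^sup>2) * (9 / 64)"
      using s e2 by (intro mult_left_mono) auto
    finally have "s * (e\<^sup>2 / 2)\<^sup>2 \<le> 9 / 64 * (s * e\<^sup>2)" by simp
    moreover have "141 / 100 * e\<^sup>2 \<le> s * e\<^sup>2" using s by (intro mult_right_mono) auto
    moreover have "p * (7 / 12 * e) = 7 / 12 * e + 7 / 9 * e\<^sup>2"
      by (simp add: p_def power2_eq_square algebra_simps)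
    moreover have "0 \<le> e\<^sup>2" by simp
    ultimately have "p * (7 / 12 * e) + s * (e\<^sup>2 / 2)\<^sup>2 \<le> 7 / 10 * (s * e\<^sup>2) + 7 / 10 * e"
      using e0 by argo
    then show ?thesis by (simp add: s_def mult.assoc)
  qed
  finally have bound: "op_norm (U - Q ** D ** conj_transpose Q) \<le>
      7 / 10 * sqrt (real CARD('n + 'n)) * e\<^sup>2 + 7 / 10 * e" .

  \<comment> \<open>Unitarity and self-duality of the phase matrix\<close>
  define d where "d j = complex_of_real (1 / cmod (T $ j $ j)) * T $ j $ j" for j
  have D: "D = (\<chi> i j. if i = j then d j else 0)" by (simp only: assms(6) d_def)
  have "T $ j $ j \<noteq> 0" for j using triangular_left_inverse(1) [OF r NT, of j] by auto
  then have "cmod (d j) = 1" for j by (simp add: d_def norm_mult norm_divide)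
  then have "unitary_matrix D" using D by (rule unitary_diagonal_matrix)
  \<comment> \<open>\<open>T0\<close> and its transpose have the same diagonal.\<close>
  moreover have "d (Inr a) = d (Inl a)" for a
    by (simp add: d_def T block_matrix_def transpose_def)
  then have "J_skew_symmetric D" using D by (rule J_skew_symmetric_diagonal_matrix)
  ultimately show ?thesis using bound by (simp add: e_def)
qed

end
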